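(* Let $n\ge2$, let $U\subset\mathbb{R}^n$ be open, $X\in C^2(U,\mathbb{R}^n)$, $p\in U$ with $X(p)=0$, $J:=DX(p)$, and assume $\operatorname{rank}J=n-1$, $e_{n-1}(J)=0$, $e_{n-2}(J)\neq0$. Let $q_0$ span $\ker J$ and let $(a,b)$ be the Bogdanov--Takens coefficients associated with $(X,p,q_0)$. On the open set $U'\subset U$ where $e_{n-2}(DX(x))\neq0$ let $$\delta:=\frac{e_n(DX)}{e_{n-2}(DX)},\qquad \tau:=\frac{e_{n-1}(DX)-\delta\,e_{n-3}(DX)}{e_{n-2}(DX)}.$$ Then $$\delta(p)=\tau(p)=0,\qquad a=-\tfrac12\,D_{q_0}\delta,\qquad b=D_{q_0}\tau,$$ where $D_{q_0}f:=\frac{d}{ds}\big|_{s=0}f(p+sq_0)$.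
   Context: For a real $m\times m$ matrix $A$, $e_k(A)$ is the sum of the principal $k\times k$ minors of $A$, so that $\det(\lambda I-A)=\sum_{k=0}^m(-1)^k e_k(A)\lambda^{m-k}$; $e_0=1$, $e_k:=0$ for $k<0$. Under the stated conditions on $J$, $\mathbb{R}^n=E^c\oplus E^{\mathrm{tr}}$ with $E^c:=\ker J^2$, $E^{\mathrm{tr}}:=\operatorname{im}J^2$, both $J$-invariant, $\dim E^c=2$, $J|_{E^c}$ nilpotent of rank one. Definition of $(a,b)$: choose $q_1\in E^c$ with $Jq_1=q_0$; let $p_0,p_1$ be the covectors determined by $\langle p_0,q_0\rangle=\langle p_1,q_1\rangle=1$, $\langle p_0,q_1\rangle=\langle p_1,q_0\rangle=0$, $p_0|_{E^{\mathrm{tr}}}=p_1|_{E^{\mathrm{tr}}}=0$. With $B(u,v):=D^2X(p)[u,v]$, $a:=\tfrac12\langle p_1,B(q_0,q_0)\rangle$ and $b:=\langle p_0,B(q_0,q_0)\rangle+\langle p_1,B(q_0,q_1)\rangle$; the pair does not depend on the choice of $q_1$. *)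

theory Defs
  imports "HOL-Analysis.Analysis"
begin

(* Determinant of the submatrix of A with rows and columns in S: the Leibniz formula of
   det_def with the index set UNIV replaced by S. *)
definition principal_minor :: "'a::comm_ring_1^'n^'n \<Rightarrow> 'n set \<Rightarrow> 'a" where
  "principal_minor A S =
    (\<Sum>\<pi> | \<pi> permutes S. of_int (sign \<pi>) * (\<Prod>i\<in>S. A $ i $ \<pi> i))"

(* The index k is an integer so that e_k = 0 for k < 0 and no subtraction in an index
   is truncated. *)
definition e_minors :: "int \<Rightarrow> 'a::comm_ring_1^'n^'n \<Rightarrow> 'a" where
  "e_minors k A = (\<Sum>S | int (card S) = k. principal_minor A S)"

lemma e_minors_neg: "k < 0 \<Longrightarrow> e_minors k A = 0"
  by (simp add: e_minors_def)

lemma e_minors_0: "e_minors 0 A = 1"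
proof -
  have "{S :: 'b set. int (card S) = 0} = {{}}" by auto
  then show ?thesis by (simp add: e_minors_def principal_minor_def)
qed

lemma e_minors_CARD: "e_minors (int CARD('n)) (A :: 'a::comm_ring_1^'n^'n) = det A"
proof -
  have "{S :: 'n set. int (card S) = int CARD('n)} = {UNIV}"
    using card_eq_UNIV_imp_eq_UNIV[where ?'a = 'n] by auto
  then show ?thesis by (simp add: e_minors_def principal_minor_def det_def)
qed

definition Df :: "('a::real_normed_vector \<Rightarrow> 'b::real_normed_vector) \<Rightarrow> 'a \<Rightarrow> 'a \<Rightarrow>\<^sub>L 'b" where
  "Df f x = Blinfun (frechet_derivative f (at x))"

(* Intended for open U: all derivatives are full derivatives at the points of U. *)
definition C2_on :: "('a::real_normed_vector \<Rightarrow> 'b::real_normed_vector) \<Rightarrow> 'a set \<Rightarrow> bool" where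
  "C2_on f U \<longleftrightarrow>
    (\<forall>x\<in>U. f differentiable (at x)) \<and>
    (\<forall>x\<in>U. Df f differentiable (at x)) \<and>
    continuous_on U (Df (Df f))"

definition D2 :: "('a::real_normed_vector \<Rightarrow> 'b::real_normed_vector) \<Rightarrow> 'a \<Rightarrow> 'a \<Rightarrow> 'a \<Rightarrow> 'b" where
  "D2 f x u v = blinfun_apply (blinfun_apply (Df (Df f) x) u) v"

(* q1 and the covectors p0, p1 dual to (q0, q1), where E^c = ker J^2 and E^tr = im J^2. *)
definition bt_frame ::
  "real^'n^'n \<Rightarrow> real^'n \<Rightarrow> real^'n \<Rightarrow> (real^'n \<Rightarrow> real) \<Rightarrow> (real^'n \<Rightarrow> real) \<Rightarrow> bool" where
  "bt_frame J q0 q1 p0 p1 \<longleftrightarrow>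
    q1 \<in> {v. (J ** J) *v v = 0} \<and> J *v q1 = q0 \<and>
    linear p0 \<and> linear p1 \<and>
    p0 q0 = 1 \<and> p1 q1 = 1 \<and> p0 q1 = 0 \<and> p1 q0 = 0 \<and>
    (\<forall>w \<in> range (\<lambda>v. (J ** J) *v v). p0 w = 0 \<and> p1 w = 0)"

(* The definite description is meaningful because, under the rank and e_k conditions on J,
   a frame exists and the resulting pair is the same for all frames. *)
definition bogdanov_takens_coeffs ::
  "(real^'n \<Rightarrow> real^'n) \<Rightarrow> real^'n \<Rightarrow> real^'n \<Rightarrow> real \<times> real" where
  "bogdanov_takens_coeffs X p q0 =
    (THE ab. \<exists>q1 p0 p1. bt_frame (jacobian X (at p)) q0 q1 p0 p1 \<and>
      ab = (1/2 * p1 (D2 X p q0 q0), p0 (D2 X p q0 q0) + p1 (D2 X p q0 q1)))"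

(* Only used at points where the denominator, the minor sum of index n - 2, is nonzero. *)
definition bt_delta :: "(real^'n \<Rightarrow> real^'n) \<Rightarrow> real^'n \<Rightarrow> real" where
  "bt_delta X x =
    e_minors (int CARD('n)) (jacobian X (at x)) /
    e_minors (int CARD('n) - 2) (jacobian X (at x))"

definition bt_tau :: "(real^'n \<Rightarrow> real^'n) \<Rightarrow> real^'n \<Rightarrow> real" where
  "bt_tau X x =
    (e_minors (int CARD('n) - 1) (jacobian X (at x))
      - bt_delta X x * e_minors (int CARD('n) - 3) (jacobian X (at x))) /
    e_minors (int CARD('n) - 2) (jacobian X (at x))"

end

theory Submission
  imports Defs
begin

text \<open>Let \<open>c\<^sub>k\<close> be the coefficients of \<open>det (\<lambda>I - J)\<close> and \<open>D\<^sub>k\<close> the matrix coefficients of the adjugate of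
  \<open>\<lambda>I - J\<close>. By Jacobi's formula the derivative of \<open>c\<^sub>k\<close> in a direction \<open>M\<close> is \<open>- tr (D\<^sub>k M)\<close>.
  Here \<open>c\<^sub>0 = c\<^sub>1 = 0\<close>, and comparing powers of \<open>\<lambda>\<close> in
  \<open>(\<lambda>I - J) adj (\<lambda>I - J) = det (\<lambda>I - J) I\<close> yields, for every frame,
  \<open>D\<^sub>0 = c\<^sub>2 q\<^sub>0 p\<^sub>1\<close> and \<open>D\<^sub>1 = c\<^sub>2 (q\<^sub>0 p\<^sub>0 + q\<^sub>1 p\<^sub>1) + c\<^sub>3 q\<^sub>0 p\<^sub>1\<close>. With \<open>M = B(q\<^sub>0, \<cdot>)\<close> the two traces
  are \<open>2 a c\<^sub>2\<close> and \<open>b c\<^sub>2 + 2 a c\<^sub>3\<close>, while \<open>\<delta> = c\<^sub>0 / c\<^sub>2\<close> and \<open>\<tau> = (\<delta> c\<^sub>3 - c\<^sub>1) / c\<^sub>2\<close>. Since the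
  computation is valid for every frame, it also shows that \<open>(a, b)\<close> does not depend on the frame.\<close>

subsection \<open>Adjugate matrices and Jacobi's formula\<close>

text \<open>The cofactor is the determinant with row j replaced by a unit vector, so no smaller
  index type is involved.\<close>

definition adjugate :: "'a::comm_ring_1^'n^'n \<Rightarrow> 'a^'n^'n" where
  "adjugate A = (\<chi> i j. det (\<chi> k. if k = j then axis i 1 else A $ k))"

text \<open>Laplace expansion along row j, by linearity in that row. Leaving v arbitrary serves both
  \<open>mult_adjugate\<close> and Jacobi's formula.\<close>

lemma det_replace_row:
  fixes A :: "'a::comm_ring_1^'n^'n"
  shows "det (\<chi> k. if k = j then v else A $ k) = (\<Sum>i\<in>UNIV. v $ i * adjugate A $ i $ j)"
proof -
  have "det (\<chi> k. if k = j then v else A $ k) =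
      det (\<chi> k. if k = j then (\<Sum>i\<in>UNIV. v $ i *s axis i 1) else A $ k)"
    by (simp only: basis_expansion)
  also have "\<dots> = (\<Sum>i\<in>UNIV. det (\<chi> k. if k = j then v $ i *s axis i 1 else A $ k))"
    by (rule det_linear_row_sum) simp
  also have "\<dots> = (\<Sum>i\<in>UNIV. v $ i * adjugate A $ i $ j)"
    by (simp add: adjugate_def det_row_mul)
  finally show ?thesis .
qed

lemma mult_adjugate: "A ** adjugate A = mat (det A)"
proof -
  have "(A ** adjugate A) $ i $ j = mat (det A) $ i $ j" for i j
  proof -
    have "(A ** adjugate A) $ i $ j = det (\<chi> k. if k = j then A $ i else A $ k)"
      by (simp add: det_replace_row matrix_matrix_mult_def)
    also have "\<dots> = mat (det A) $ i $ j"
    proof (cases "i = j")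
      case True
      then have "(\<chi> k. if k = j then A $ i else A $ k) = A"
        by (simp add: vec_eq_iff)
      with True show ?thesis by (simp add: mat_def)
    next
      case False
      have "det (\<chi> k. if k = j then A $ i else A $ k) = 0"
        by (rule det_identical_rows[OF False]) (use False in \<open>simp add: row_def\<close>)
      with False show ?thesis by (simp add: mat_def)
    qed
    finally show ?thesis .
  qed
  then show ?thesis by (simp add: vec_eq_iff)
qed

text \<open>Replacing row j by a unit vector gives the same determinant as replacing column i by
  one. This transfers \<open>mult_adjugate\<close> to the product in the other order.\<close>

lemma adjugate_transpose: "adjugate (transpose A) = transpose (adjugate A)"
proof -
  have "adjugate (transpose A) $ j $ i = adjugate A $ i $ j" for i j
  proof -
    let ?R = "\<chi> k. if k = j then axis i 1 else A $ k"
    let ?C = "\<chi> k l. if l = i then (if k = j then 1 else 0) else A $ k $ l"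
    \<comment> \<open>The Leibniz terms agree one by one: both vanish unless \<pi> sends j to i, and
      then only entries of A outside row j and column i occur.\<close>
    have "(\<Prod>k\<in>UNIV. ?R $ k $ \<pi> k) = (\<Prod>k\<in>UNIV. ?C $ k $ \<pi> k)"
      if \<pi>: "\<pi> permutes UNIV" for \<pi>
    proof (cases "\<pi> j = i")
      case True
      then have "?R $ k $ \<pi> k = ?C $ k $ \<pi> k" for k
        using permutes_inj[OF \<pi>] by (auto simp: axis_def dest: injD)
      then show ?thesis by (intro prod.cong) auto
    next
      case False
      obtain k where k: "\<pi> k = i" using permutes_surj[OF \<pi>] by (metis surj_def)
      have "?R $ j $ \<pi> j = 0" using False by (simp add: axis_def)
      then have R: "(\<Prod>k\<in>UNIV. ?R $ k $ \<pi> k) = 0" by (intro prod_zero) auto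
      have "?C $ k $ \<pi> k = 0" using False k by auto
      then have "(\<Prod>k\<in>UNIV. ?C $ k $ \<pi> k) = 0" by (intro prod_zero bexI[of _ k]) auto
      with R show ?thesis by simp
    qed
    then have "det ?R = det ?C"
      unfolding det_def by (intro sum.cong arg_cong2[where f="(*)"]) auto
    also have "\<dots> = det (transpose ?C)" by simp
    also have "transpose ?C = (\<chi> l. if l = i then axis j 1 else transpose A $ l)"
      by (auto simp: vec_eq_iff transpose_def axis_def)
    finally show ?thesis by (simp add: adjugate_def)
  qed
  then show ?thesis by (simp add: vec_eq_iff transpose_def)
qed

lemma adjugate_mult: "adjugate A ** A = mat (det A)"
proof -
  have "transpose (adjugate A ** A) = transpose A ** adjugate (transpose A)"
    by (simp add: matrix_transpose_mul adjugate_transpose)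
  also have "\<dots> = mat (det A)" by (simp add: mult_adjugate)
  finally show ?thesis by (metis transpose_transpose transpose_mat)
qed

text \<open>Jacobi's formula: the product rule in the Leibniz sum, regrouped by the differentiated
  row, gives determinants with one row taken from M.\<close>

lemma has_field_derivative_det:
  fixes A :: "'a::real_normed_field \<Rightarrow> 'a^'n^'n"
  assumes "\<And>i j. ((\<lambda>s. A s $ i $ j) has_field_derivative M $ i $ j) (at x)"
  shows "((\<lambda>s. det (A s)) has_field_derivative trace (adjugate (A x) ** M)) (at x)"
proof -
  let ?P = "{\<pi>. \<pi> permutes (UNIV :: 'n set)}"
  have "((\<lambda>s. det (A s)) has_field_derivative
      (\<Sum>\<pi>\<in>?P. of_int (sign \<pi>) *
        (\<Sum>i\<in>UNIV. M $ i $ \<pi> i * (\<Prod>k\<in>UNIV - {i}. A x $ k $ \<pi> k)))) (at x)"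
    unfolding det_def by (intro DERIV_sum DERIV_cmult has_field_derivative_prod assms)
  also have "(\<Sum>\<pi>\<in>?P. of_int (sign \<pi>) *
        (\<Sum>i\<in>UNIV. M $ i $ \<pi> i * (\<Prod>k\<in>UNIV - {i}. A x $ k $ \<pi> k))) =
      (\<Sum>i\<in>UNIV. \<Sum>\<pi>\<in>?P. of_int (sign \<pi>) *
        (M $ i $ \<pi> i * (\<Prod>k\<in>UNIV - {i}. A x $ k $ \<pi> k)))"
    unfolding sum_distrib_left by (rule sum.swap)
  also have "\<dots> = (\<Sum>i\<in>UNIV. det (\<chi> k. if k = i then M $ i else A x $ k))"
  proof (intro sum.cong refl)
    fix i :: 'n
    have "(\<Prod>k\<in>UNIV. (\<chi> k. if k = i then M $ i else A x $ k) $ k $ \<pi> k) =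
        M $ i $ \<pi> i * (\<Prod>k\<in>UNIV - {i}. A x $ k $ \<pi> k)" for \<pi>
      by (subst prod.remove[of _ i]) auto
    then show "(\<Sum>\<pi>\<in>?P. of_int (sign \<pi>) *
        (M $ i $ \<pi> i * (\<Prod>k\<in>UNIV - {i}. A x $ k $ \<pi> k))) =
        det (\<chi> k. if k = i then M $ i else A x $ k)"
      by (simp add: det_def)
  qed
  also have "\<dots> = trace (M ** adjugate (A x))"
    by (simp add: det_replace_row trace_def matrix_matrix_mult_def)
  also have "\<dots> = trace (adjugate (A x) ** M)" by (rule trace_mul_sym)
  finally show ?thesis .
qed

subsection \<open>The characteristic polynomial\<close>

text \<open>Expand each Leibniz product, T being the set of rows that contribute an entry of -A. The
  other rows contribute a power of x if \<pi> fixes them, that is if \<pi> permutes T, and 0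
  otherwise.\<close>

lemma det_mat_diff:
  fixes A :: "'a::comm_ring_1^'n^'n"
  shows "det (mat x - A) =
    (\<Sum>T\<in>UNIV. (-1) ^ card T * principal_minor A T * x ^ (CARD('n) - card T))"
proof -
  have *: "(\<Prod>i\<in>-T. if \<pi> i = i then x else 0) =
      (if \<pi> permutes T then x ^ (CARD('n) - card T) else 0)"
    if "\<pi> permutes UNIV" for \<pi> :: "'n \<Rightarrow> 'n" and T
  proof (cases "\<forall>i\<in>-T. \<pi> i = i")
    case True
    then have "\<pi> permutes T" using that by (auto simp: permutes_def)
    moreover have "card (- T) = CARD('n) - card T" by (simp add: Compl_eq_Diff_UNIV card_Diff_subset)
    ultimately show ?thesis using True by simp
  next
    case False
    then obtain i where "i \<in> -T" "\<pi> i \<noteq> i" by blast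
    then have "(\<Prod>i\<in>-T. if \<pi> i = i then x else 0) = 0" by (intro prod_zero) auto
    with False show ?thesis by (auto simp: permutes_def)
  qed
  have "det (mat x - A) = (\<Sum>\<pi> | \<pi> permutes UNIV. of_int (sign \<pi>) *
      (\<Prod>i\<in>UNIV. - A $ i $ \<pi> i + (if \<pi> i = i then x else 0)))"
    unfolding det_def by (intro sum.cong arg_cong2[where f="(*)"] prod.cong) (auto simp: mat_def)
  also have "\<dots> = (\<Sum>\<pi> | \<pi> permutes UNIV. \<Sum>T\<in>UNIV.
      if \<pi> permutes T
      then of_int (sign \<pi>) * ((-1) ^ card T * (\<Prod>i\<in>T. A $ i $ \<pi> i) * x ^ (CARD('n) - card T))
      else 0)"
    by (intro sum.cong refl, subst prod_add)
      (auto simp: sum_distrib_left prod_uminus * simp flip: Compl_eq_Diff_UNIV intro!: sum.cong)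
  also have "\<dots> = (\<Sum>T\<in>UNIV. \<Sum>\<pi> | \<pi> permutes UNIV.
      if \<pi> permutes T
      then of_int (sign \<pi>) * ((-1) ^ card T * (\<Prod>i\<in>T. A $ i $ \<pi> i) * x ^ (CARD('n) - card T))
      else 0)"
    by (rule sum.swap)
  also have "\<dots> = (\<Sum>T\<in>UNIV. \<Sum>\<pi> | \<pi> permutes T.
      of_int (sign \<pi>) * ((-1) ^ card T * (\<Prod>i\<in>T. A $ i $ \<pi> i) * x ^ (CARD('n) - card T)))"
    by (rule sum.cong[OF refl], rule sum.mono_neutral_cong_right) (auto intro: permutes_subset)
  also have "\<dots> = (\<Sum>T\<in>UNIV. (-1) ^ card T * principal_minor A T * x ^ (CARD('n) - card T))"
    by (simp add: principal_minor_def sum_distrib_left sum_distrib_right ac_simps)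
  finally show ?thesis .
qed

definition char_mat :: "'a::comm_ring_1^'n^'n \<Rightarrow> 'a poly^'n^'n" where
  "char_mat A = mat [:0, 1:] - (\<chi> i j. [:A $ i $ j:])"

definition charpoly :: "'a::comm_ring_1^'n^'n \<Rightarrow> 'a poly" where
  "charpoly A = det (char_mat A)"

lemma poly_det: "poly (det P) x = det (\<chi> i j. poly (P $ i $ j) x)"
  for P :: "'a::comm_ring_1 poly^'n^'n"
  by (simp add: det_def poly_sum poly_prod)

text \<open>Evaluation is a ring homomorphism, hence commutes with cofactors. This links the formal
  adjugate to the matrices to which Jacobi's formula applies.\<close>

lemma poly_adjugate:
  "poly (adjugate P $ i $ j) x = adjugate (\<chi> i j. poly (P $ i $ j) x) $ i $ j"
  unfolding adjugate_def
  by (auto simp: poly_det axis_def vec_eq_iff intro!: arg_cong[where f=det])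

lemma poly_char_mat: "(\<chi> i j. poly (char_mat A $ i $ j) x) = mat x - A"
  by (auto simp: char_mat_def mat_def vec_eq_iff)

lemma poly_charpoly: "poly (charpoly A) x = det (mat x - A)"
  by (simp add: charpoly_def poly_det poly_char_mat)

lemma principal_minor_const: "principal_minor (\<chi> i j. [:A $ i $ j:]) T = [:principal_minor A T:]"
proof -
  have "(\<Prod>i\<in>T. [:f i:]) = [:\<Prod>i\<in>T. f i:]" for f :: "'b \<Rightarrow> 'a"
    by (induction T rule: infinite_finite_induct) (auto simp: one_pCons)
  moreover have "(\<Sum>i\<in>S. [:f i:]) = [:\<Sum>i\<in>S. f i:]" for f :: "('b \<Rightarrow> 'b) \<Rightarrow> 'a" and S
    by (induction S rule: infinite_finite_induct) auto
  ultimately show ?thesis by (simp add: principal_minor_def of_int_poly mult.commute)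
qed

text \<open>The sign exponent n + k has the parity of n - k without truncation; for k > n both sides
  are 0.\<close>

lemma coeff_charpoly:
  fixes A :: "'a::comm_ring_1^'n^'n"
  shows "coeff (charpoly A) k = (-1) ^ (CARD('n) + k) * e_minors (int CARD('n) - int k) A"
proof -
  have "charpoly A = (\<Sum>T\<in>UNIV. monom ((-1) ^ card T * principal_minor A T) (CARD('n) - card T))"
    unfolding charpoly_def char_mat_def det_mat_diff principal_minor_const
  proof (intro sum.cong refl)
    fix T :: "'n set"
    have "(-1 :: 'a poly) ^ m = [:(-1) ^ m:]" for m
      by (induction m) (auto simp: one_pCons)
    then show "(-1) ^ card T * [:principal_minor A T:] * [:0, 1:] ^ (CARD('n) - card T) =
        monom ((-1) ^ card T * principal_minor A T) (CARD('n) - card T)"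
      by (simp add: monom_altdef mult.commute)
  qed
  then have "coeff (charpoly A) k =
      (\<Sum>T\<in>UNIV. if CARD('n) - card T = k then (-1) ^ card T * principal_minor A T else 0)"
    by (simp add: coeff_sum)
  also have "\<dots> = (\<Sum>T | int (card T) = int CARD('n) - int k.
      (-1) ^ (CARD('n) + k) * principal_minor A T)"
  proof (intro sum.mono_neutral_cong_right ballI)
    fix T :: "'n set"
    have T: "card T \<le> CARD('n)" by (intro card_mono) auto
    show "(if CARD('n) - card T = k then (-1) ^ card T * principal_minor A T else 0) = 0"
      if "T \<in> UNIV - {T. int (card T) = int CARD('n) - int k}"
      using that T by auto
    show "(if CARD('n) - card T = k then (-1) ^ card T * principal_minor A T else 0) =
        (-1) ^ (CARD('n) + k) * principal_minor A T"
      if "T \<in> {T. int (card T) = int CARD('n) - int k}"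
    proof -
      have "CARD('n) = card T + k" using that by auto
      then have "(-1::'a) ^ (CARD('n) + k) = (-1) ^ card T"
        by (simp add: power_add mult.assoc flip: power_mult_distrib)
      then show ?thesis using \<open>CARD('n) = card T + k\<close> by simp
    qed
  qed auto
  finally show ?thesis by (simp add: e_minors_def sum_distrib_left)
qed

section \<open>Matrix coefficients of the adjugate and their recursions\<close>

definition adj_coeff :: "'a::comm_ring_1^'n^'n \<Rightarrow> nat \<Rightarrow> 'a^'n^'n" where
  "adj_coeff A k = (\<chi> i j. coeff (adjugate (char_mat A) $ i $ j) k)"

text \<open>Multiplication by \<lambda> appears as \<open>pCons 0\<close>, which makes comparing
  coefficients an index shift.\<close>

lemma char_mat_mult_nth:
  "(char_mat A ** P) $ i $ j = pCons 0 (P $ i $ j) - (\<Sum>l\<in>UNIV. smult (A $ i $ l) (P $ l $ j))"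
proof -
  have "(char_mat A ** P) $ i $ j =
      (\<Sum>l\<in>UNIV. (if i = l then pCons 0 (P $ l $ j) else 0) - smult (A $ i $ l) (P $ l $ j))"
    unfolding matrix_matrix_mult_def vec_lambda_beta
    by (rule sum.cong) (auto simp: char_mat_def mat_def left_diff_distrib)
  then show ?thesis by (simp add: sum_subtractf)
qed

lemma mult_char_mat_nth:
  "(P ** char_mat A) $ i $ j = pCons 0 (P $ i $ j) - (\<Sum>l\<in>UNIV. smult (A $ l $ j) (P $ i $ l))"
proof -
  have "(P ** char_mat A) $ i $ j =
      (\<Sum>l\<in>UNIV. (if l = j then pCons 0 (P $ i $ l) else 0) - smult (A $ l $ j) (P $ i $ l))"
    unfolding matrix_matrix_mult_def vec_lambda_beta
    by (rule sum.cong) (auto simp: char_mat_def mat_def right_diff_distrib)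
  then show ?thesis by (simp add: sum_subtractf)
qed

lemma coeff_mat: "coeff (mat p $ i $ j) k = mat (coeff p k) $ i $ j"
  by (simp add: mat_def)

lemma mult_adj_coeff_0: "A ** adj_coeff A 0 = - mat (coeff (charpoly A) 0)"
proof -
  have "(- (A ** adj_coeff A 0)) $ i $ j = mat (coeff (charpoly A) 0) $ i $ j" for i j
    using arg_cong[OF mult_adjugate[of "char_mat A"], of "\<lambda>P. coeff (P $ i $ j) 0"]
    unfolding char_mat_mult_nth coeff_mat
    by (auto simp: adj_coeff_def matrix_matrix_mult_def coeff_sum charpoly_def)
  then have "- (A ** adj_coeff A 0) = mat (coeff (charpoly A) 0)" by (simp add: vec_eq_iff)
  then show ?thesis by (metis minus_minus)
qed

text \<open>The Faddeev-LeVerrier recursion, read off at power k + 1 of \<lambda>.\<close>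

lemma mult_adj_coeff_Suc:
  "A ** adj_coeff A (Suc k) = adj_coeff A k - mat (coeff (charpoly A) (Suc k))"
proof -
  have "(A ** adj_coeff A (Suc k)) $ i $ j =
      (adj_coeff A k - mat (coeff (charpoly A) (Suc k))) $ i $ j" for i j
    using arg_cong[OF mult_adjugate[of "char_mat A"], of "\<lambda>P. coeff (P $ i $ j) (Suc k)"]
    unfolding char_mat_mult_nth coeff_mat
    by (auto simp: adj_coeff_def matrix_matrix_mult_def coeff_sum charpoly_def algebra_simps)
  then show ?thesis by (simp add: vec_eq_iff)
qed

lemma adj_coeff_0_mult: "adj_coeff A 0 ** A = - mat (coeff (charpoly A) 0)"
proof -
  have "(- (adj_coeff A 0 ** A)) $ i $ j = mat (coeff (charpoly A) 0) $ i $ j" for i j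
    using arg_cong[OF adjugate_mult[of "char_mat A"], of "\<lambda>P. coeff (P $ i $ j) 0"]
    unfolding mult_char_mat_nth coeff_mat
    by (auto simp: adj_coeff_def matrix_matrix_mult_def coeff_sum charpoly_def
        mult.commute)
  then have "- (adj_coeff A 0 ** A) = mat (coeff (charpoly A) 0)" by (simp add: vec_eq_iff)
  then show ?thesis by (metis minus_minus)
qed

lemma adj_coeff_Suc_mult:
  "adj_coeff A (Suc k) ** A = adj_coeff A k - mat (coeff (charpoly A) (Suc k))"
proof -
  have "(adj_coeff A (Suc k) ** A) $ i $ j =
      (adj_coeff A k - mat (coeff (charpoly A) (Suc k))) $ i $ j" for i j
    using arg_cong[OF adjugate_mult[of "char_mat A"], of "\<lambda>P. coeff (P $ i $ j) (Suc k)"]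
    unfolding mult_char_mat_nth coeff_mat
    by (auto simp: adj_coeff_def matrix_matrix_mult_def coeff_sum charpoly_def algebra_simps)
  then show ?thesis by (simp add: vec_eq_iff)
qed

section \<open>Derivatives of the coefficients of the characteristic polynomial\<close>

lemma poly_trace_adjugate:
  "poly (trace (adjugate (char_mat A) ** (\<chi> i j. [:M $ i $ j:]))) x =
    trace (adjugate (mat x - A) ** M)"
  by (simp add: trace_def matrix_matrix_mult_def poly_sum poly_adjugate poly_char_mat)
    (simp only: mult.commute)

text \<open>The values of this polynomial come from Jacobi's formula, its coefficients are the
  traces wanted; equality of polynomial functions passes from one to the other.\<close>

lemma coeff_trace_adjugate:
  "coeff (trace (adjugate (char_mat A) ** (\<chi> i j. [:M $ i $ j:]))) k =
    trace (adj_coeff A k ** M)"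
  by (simp add: trace_def matrix_matrix_mult_def coeff_sum adj_coeff_def mult.commute)

text \<open>Jacobi's formula for the derivative of det (xI - A) in x, compared
  coefficientwise.\<close>

lemma trace_adj_coeff:
  fixes A :: "'a::real_normed_field^'n^'n"
  shows "trace (adj_coeff A k) = of_nat (Suc k) * coeff (charpoly A) (Suc k)"
proof -
  have "poly (pderiv (charpoly A)) x =
      poly (trace (adjugate (char_mat A) ** (\<chi> i j. [:mat 1 $ i $ j:]))) x" for x
  proof (rule DERIV_unique)
    show "(poly (charpoly A) has_field_derivative poly (pderiv (charpoly A)) x) (at x)"
      by (rule poly_DERIV)
    have "((\<lambda>x. (mat x - A) $ i $ j) has_field_derivative mat 1 $ i $ j) (at x)" for i j
      by (cases "i = j") (auto simp: mat_def intro!: derivative_eq_intros)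
    from has_field_derivative_det[of "\<lambda>x. mat x - A", OF this]
    show "(poly (charpoly A) has_field_derivative
        poly (trace (adjugate (char_mat A) ** (\<chi> i j. [:mat 1 $ i $ j:]))) x) (at x)"
      unfolding poly_trace_adjugate poly_charpoly[abs_def, symmetric] .
  qed
  then have "poly (pderiv (charpoly A)) =
      poly (trace (adjugate (char_mat A) ** (\<chi> i j. [:mat 1 $ i $ j:])))"
    by (rule ext)
  then have "pderiv (charpoly A) = trace (adjugate (char_mat A) ** (\<chi> i j. [:mat 1 $ i $ j:]))"
    by (simp only: poly_eq_poly_eq_iff)
  then have "coeff (pderiv (charpoly A)) k = trace (adj_coeff A k ** mat 1)"
    by (simp only: coeff_trace_adjugate)
  then show ?thesis by (simp add: coeff_pderiv matrix_mul_rid)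
qed

lemma e_minors_field_differentiable:
  fixes A :: "'a::real_normed_field \<Rightarrow> 'a^'n^'n"
  assumes "\<And>i j. ((\<lambda>s. A s $ i $ j) has_field_derivative M $ i $ j) (at x)"
  shows "(\<lambda>s. e_minors k (A s)) field_differentiable (at x)"
  unfolding field_differentiable_def
proof
  show "((\<lambda>s. e_minors k (A s)) has_field_derivative
    (\<Sum>T | int (card T) = k. \<Sum>\<pi> | \<pi> permutes T. of_int (sign \<pi>) *
      (\<Sum>i\<in>T. M $ i $ \<pi> i * (\<Prod>j\<in>T - {i}. A x $ j $ \<pi> j)))) (at x)"
    unfolding e_minors_def principal_minor_def
    by (intro DERIV_sum DERIV_cmult has_field_derivative_prod assms)
qed

text \<open>The coefficients have some derivatives \<open>d k\<close>, being polynomial in the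
  entries. For each fixed y, det (yI - A(s)) is differentiated in s both through them and by
  Jacobi's formula, so the polynomials P and Q coincide.\<close>

lemma has_field_derivative_coeff_charpoly:
  fixes A :: "'a::real_normed_field \<Rightarrow> 'a^'n^'n"
  assumes A: "\<And>i j. ((\<lambda>s. A s $ i $ j) has_field_derivative M $ i $ j) (at x)"
  shows "((\<lambda>s. coeff (charpoly (A s)) k) has_field_derivative
    - trace (adj_coeff (A x) k ** M)) (at x)"
proof -
  have "\<exists>d. ((\<lambda>s. coeff (charpoly (A s)) k) has_field_derivative d) (at x)" for k
  proof -
    obtain d where "((\<lambda>s. e_minors (int CARD('n) - int k) (A s)) has_field_derivative d) (at x)"
      using e_minors_field_differentiable[OF A] unfolding field_differentiable_def by (rule exE)
    from DERIV_cmult[OF this] show ?thesis unfolding coeff_charpoly by (rule exI)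
  qed
  then obtain d where
    d: "((\<lambda>s. coeff (charpoly (A s)) k) has_field_derivative d k) (at x)" for k
    by metis
  have c0: "coeff (charpoly B) k = 0" if "k > CARD('n)" for B :: "'a^'n^'n" and k
    using that by (simp add: coeff_charpoly e_minors_neg)
  then have d0: "d k = 0" if "k > CARD('n)" for k
    using d[of k] that by (auto dest: DERIV_unique[OF _ DERIV_const])
  define P where "P = (\<Sum>k\<le>CARD('n). monom (d k) k)"
  define Q where "Q = - trace (adjugate (char_mat (A x)) ** (\<chi> i j. [:M $ i $ j:]))"
  have "poly P y = poly Q y" for y
  proof (rule DERIV_unique)
    have "poly (charpoly B) y = (\<Sum>k\<le>CARD('n). coeff (charpoly B) k * y ^ k)" for B :: "'a^'n^'n"
    proof -
      have "degree (charpoly B) \<le> CARD('n)" by (rule degree_le) (simp add: c0)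
      from poly_as_sum_of_monoms'[OF this]
      have "poly (charpoly B) y = poly (\<Sum>k\<le>CARD('n). monom (coeff (charpoly B) k) k) y"
        by (rule arg_cong[OF sym])
      then show ?thesis by (simp only: poly_sum poly_monom)
    qed
    then show "((\<lambda>s. poly (charpoly (A s)) y) has_field_derivative poly P y) (at x)"
      by (simp add: P_def poly_sum poly_monom DERIV_sum DERIV_cmult_right d)
    have "((\<lambda>s. (mat y - A s) $ i $ j) has_field_derivative (- M) $ i $ j) (at x)" for i j
      by (auto intro!: derivative_eq_intros A)
    from has_field_derivative_det[of "\<lambda>s. mat y - A s", OF this]
    have "((\<lambda>s. poly (charpoly (A s)) y) has_field_derivative
        trace (adjugate (mat y - A x) ** (- M))) (at x)"
      by (simp add: poly_charpoly)
    also have "trace (adjugate (mat y - A x) ** (- M)) = poly Q y"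
      unfolding Q_def poly_minus poly_trace_adjugate
      by (simp add: trace_def matrix_matrix_mult_def sum_negf)
    finally show "((\<lambda>s. poly (charpoly (A s)) y) has_field_derivative poly Q y) (at x)" .
  qed
  then have "poly P = poly Q" by (rule ext)
  then have "P = Q" by (simp only: poly_eq_poly_eq_iff)
  then have "coeff P k = - trace (adj_coeff (A x) k ** M)"
    by (simp add: Q_def coeff_trace_adjugate)
  moreover have "coeff P k = d k"
    by (auto simp: P_def coeff_sum d0)
  ultimately show ?thesis using d[of k] by simp
qed

subsection \<open>Matrices with a double zero eigenvalue of rank one\<close>

text \<open>N is a sum of two outer products; by cyclicity the trace is that of M N, whose diagonal
  is read off on the standard basis.\<close>

lemma trace_mult_outer:
  fixes N M :: "real^'n^'n"
  assumes "linear f" "linear g" and N: "\<And>w. N *v w = f w *\<^sub>R a + g w *\<^sub>R b"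
  shows "trace (N ** M) = f (M *v a) + g (M *v b)"
proof -
  have lin: "(\<Sum>i\<in>UNIV. h (axis i 1) * v $ i) = h v" if "linear h"
    for h :: "real^'n \<Rightarrow> real" and v
  proof -
    have "h v = h (\<Sum>i\<in>UNIV. v $ i *\<^sub>R axis i 1)"
      by (simp add: basis_expansion flip: scalar_mult_eq_scaleR)
    also have "\<dots> = (\<Sum>i\<in>UNIV. h (axis i 1) * v $ i)"
      by (simp add: linear_sum[OF that] linear_cmul[OF that] mult.commute)
    finally show ?thesis by simp
  qed
  have "(M ** N) $ i $ i = f (axis i 1) * (M *v a) $ i + g (axis i 1) * (M *v b) $ i" for i
  proof -
    have "(M ** N) $ i $ i = ((M ** N) *v axis i 1) $ i"
      by (simp add: matrix_vector_mult_basis column_def)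
    also have "\<dots> = (M *v (N *v axis i 1)) $ i"
      by (simp add: matrix_vector_mul_assoc)
    finally show ?thesis by (simp add: N matrix_vector_right_distrib matrix_vector_mult_scaleR)
  qed
  then have "trace (M ** N) = f (M *v a) + g (M *v b)"
    by (simp add: trace_def sum.distrib lin assms)
  then show ?thesis by (simp only: trace_mul_sym[of N M])
qed

lemma mat_mult_vec: "mat c *v v = c *\<^sub>R v" for v :: "real^'n"
  by (auto simp: vec_eq_iff matrix_vector_mult_def mat_def if_distrib if_distribR cong: if_cong)

text \<open>The conditions on c_0, c_1, c_2 make 0 a root of multiplicity exactly two, and the
  kernel is at most a line; \<open>q0_nonzero\<close> is derived below.\<close>

locale double_zero_matrix =
  fixes J :: "real^'n^'n" and q0 :: "real^'n"
  assumes coeff_0: "coeff (charpoly J) 0 = 0"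
    and coeff_1: "coeff (charpoly J) (Suc 0) = 0"
    and coeff_2: "coeff (charpoly J) 2 \<noteq> 0"
    and kernel: "span {q0} = {v. J *v v = 0}"
begin

abbreviation "D k v \<equiv> adj_coeff J k *v v"
abbreviation "c2 \<equiv> coeff (charpoly J) 2"
abbreviation "c3 \<equiv> coeff (charpoly J) 3"

lemma J_q0: "J *v q0 = 0"
  using kernel span_base by blast

lemma kernelE:
  assumes "J *v v = 0"
  obtains c where "v = c *\<^sub>R q0"
  using assms kernel by (auto simp: span_singleton)

lemma J_D0: "J *v D 0 v = 0"
  by (simp add: matrix_vector_mul_assoc mult_adj_coeff_0 coeff_0)

lemma J_D1: "J *v D (Suc 0) v = D 0 v"
  using mult_adj_coeff_Suc[of J 0] coeff_1
  by (simp add: matrix_vector_mul_assoc)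

lemma J_D2: "J *v D 2 v = D (Suc 0) v - c2 *\<^sub>R v"
  using mult_adj_coeff_Suc[of J "Suc 0"]
  by (simp add: matrix_vector_mul_assoc matrix_vector_mult_diff_rdistrib mat_mult_vec numeral_2_eq_2)

lemma D0_J: "D 0 (J *v v) = 0"
  by (simp add: matrix_vector_mul_assoc adj_coeff_0_mult coeff_0)

lemma D1_J: "D (Suc 0) (J *v v) = D 0 v"
  using adj_coeff_Suc_mult[of J 0] coeff_1
  by (simp add: matrix_vector_mul_assoc)

lemma D2_J: "D 2 (J *v v) = D (Suc 0) v - c2 *\<^sub>R v"
  using adj_coeff_Suc_mult[of J "Suc 0"]
  by (simp add: matrix_vector_mul_assoc matrix_vector_mult_diff_rdistrib mat_mult_vec numeral_2_eq_2)

lemma D3_J: "D 3 (J *v v) = D 2 v - c3 *\<^sub>R v"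
  using adj_coeff_Suc_mult[of J 2]
  by (simp add: matrix_vector_mul_assoc matrix_vector_mult_diff_rdistrib mat_mult_vec eval_nat_numeral)

text \<open>As J kills q0, the recursion makes q0 an eigenvector of each D_k, with eigenvalue
  c_(k+1).\<close>

lemma D0_q0: "D 0 q0 = 0"
  using D1_J[of q0] by (simp add: J_q0)

lemma D1_q0: "D (Suc 0) q0 = c2 *\<^sub>R q0"
  using D2_J[of q0] by (simp add: J_q0)

lemma D2_q0: "D 2 q0 = c3 *\<^sub>R q0"
  using D3_J[of q0] by (simp add: J_q0)

lemma decomposition:
  obtains u z where "w = u + J *v (J *v z)" "J *v (J *v u) = 0"
proof
  \<comment> \<open>Obtained by inserting c_2 v = D_1 v - J D_2 v, taken at v = D_2 w, into the same
    identity at v = w. J^2 kills the D_1 terms because J D_1 = D_0 and J D_0 = 0.\<close>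
  let ?u = "(1 / c2) *\<^sub>R D (Suc 0) w - (1 / c2\<^sup>2) *\<^sub>R (J *v D (Suc 0) (D 2 w))"
  let ?z = "(1 / c2\<^sup>2) *\<^sub>R D 2 (D 2 w)"
  have "c2\<^sup>2 *\<^sub>R (?u + J *v (J *v ?z)) = c2\<^sup>2 *\<^sub>R w"
    using coeff_2
    by (simp add: matrix_vector_mult_scaleR scaleR_add_right scaleR_diff_right power2_eq_square
        J_D2 matrix_vector_mult_diff_distrib J_D1)
  with coeff_2 show "w = ?u + J *v (J *v ?z)" by simp
  show "J *v (J *v ?u) = 0"
    by (simp add: matrix_vector_mult_scaleR matrix_vector_mult_diff_distrib J_D1 J_D0)
qed

text \<open>If the eigenvalue 0 were semisimple, \<open>adj_coeff J (Suc 0)\<close> would be \<open>c2\<close> times the projection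
  onto the kernel, of trace \<open>c2\<close>; but differentiating the characteristic polynomial gives trace
  \<open>2 * c2\<close>.\<close>

lemma D0_nonzero: "\<exists>w. D 0 w \<noteq> 0"
proof (rule ccontr)
  assume "\<nexists>w. D 0 w \<noteq> 0"
  then have "J *v D (Suc 0) w = 0" for w by (simp add: J_D1)
  then have "\<exists>c. D (Suc 0) w = c *\<^sub>R q0" for w by (metis kernelE)
  \<comment> \<open>q0 = 0 is not excluded yet; in that case both sides vanish.\<close>
  then have D1: "D (Suc 0) w = ((D (Suc 0) w \<bullet> q0) / (q0 \<bullet> q0)) *\<^sub>R q0" for w
    by (metis inner_scaleR_left nonzero_mult_div_cancel_right inner_eq_zero_iff scaleR_zero_right)
  have "linear (\<lambda>w. (D (Suc 0) w \<bullet> q0) / (q0 \<bullet> q0))"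
    by (intro linearI) (simp_all add: matrix_vector_right_distrib matrix_vector_mult_scaleR
        inner_add_left add_divide_distrib)
  from trace_mult_outer[OF this linear_zero, of "adj_coeff J (Suc 0)" q0 q0 "mat 1"] D1
  have "trace (adj_coeff J (Suc 0)) = (D (Suc 0) q0 \<bullet> q0) / (q0 \<bullet> q0)"
    by (simp add: matrix_mul_rid)
  moreover have "trace (adj_coeff J (Suc 0)) = 2 * c2"
    by (simp add: trace_adj_coeff numeral_2_eq_2)
  ultimately show False using coeff_2 by (cases "q0 = 0") (auto simp: D1_q0)
qed

lemma q0_nonzero: "q0 \<noteq> 0"
  by (metis D0_nonzero J_D0 kernelE scaleR_zero_right)

section \<open>The Jordan chain and its dual covectors\<close>

lemma q1_exists: obtains q1 where "J *v q1 = q0"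
proof -
  obtain w where w: "D 0 w \<noteq> 0" using D0_nonzero by blast
  obtain c where c: "D 0 w = c *\<^sub>R q0" using J_D0 by (rule kernelE)
  \<comment> \<open>D_0 = J D_1 places a nonzero multiple of q0 in the image of J.\<close>
  have "J *v ((1 / c) *\<^sub>R D (Suc 0) w) = q0" using w c by (auto simp: matrix_vector_mult_scaleR J_D1)
  then show ?thesis by (rule that)
qed

lemma D0_q1: "J *v q1 = q0 \<Longrightarrow> D 0 q1 = c2 *\<^sub>R q0"
  using D1_J[of q1] D1_q0 by simp

lemma D1_q1: "J *v q1 = q0 \<Longrightarrow> D (Suc 0) q1 = c2 *\<^sub>R q1 + c3 *\<^sub>R q0"
  using D2_J[of q1] by (simp add: D2_q0)

lemma frame_exists: "\<exists>q1 p0 p1. bt_frame J q0 q1 p0 p1"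
proof -
  obtain q1 where q1: "J *v q1 = q0" by (rule q1_exists)
  \<comment> \<open>h measures multiples of c_2 q0. The covectors are solved from the intended forms
    of D_0 and D_1: D_0 w = c_2 p1(w) q0 and D_1 w - p1(w) D_1 q1 = c_2 p0(w) q0. They vanish on im
    J^2 since D_0 J = 0 and D_1 J = D_0.\<close>
  define h where "h v = (v \<bullet> q0) / (c2 * (q0 \<bullet> q0))" for v
  have h_lin: "h (u + v) = h u + h v" "h (u - v) = h u - h v" "h (c *\<^sub>R v) = c * h v" for u v c
    by (simp_all add: h_def inner_add_left inner_diff_left add_divide_distrib diff_divide_distrib)
  have h: "h (c2 *\<^sub>R q0) = 1" using coeff_2 q0_nonzero by (simp add: h_def)
  define p1 where "p1 w = h (D 0 w)" for w
  define p0 where "p0 w = h (D (Suc 0) w - p1 w *\<^sub>R D (Suc 0) q1)" for w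
  note mv = matrix_vector_right_distrib matrix_vector_mult_scaleR
  have p1_lin: "p1 (u + v) = p1 u + p1 v" "p1 (c *\<^sub>R v) = c * p1 v" for u v c
    by (simp_all add: p1_def mv h_lin)
  have "linear p1" by (intro linearI) (simp_all add: p1_lin)
  moreover have "linear p0"
    by (intro linearI) (simp_all add: p0_def p1_lin h_lin mv algebra_simps)
  moreover have p1q: "p1 q1 = 1" "p1 q0 = 0"
    using h by (simp_all add: p1_def D0_q1[OF q1] D0_q0) (simp add: h_def)
  moreover have "p0 q0 = 1" using h by (simp add: p0_def p1q D1_q0)
  moreover have "p0 q1 = 0" by (simp add: p0_def p1q) (simp add: h_def)
  moreover have "p1 (J *v (J *v v)) = 0" "p0 (J *v (J *v v)) = 0" for v
    by (simp_all add: p0_def p1_def D1_J D0_J) (simp_all add: h_def)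
  ultimately have "bt_frame J q0 q1 p0 p1"
    by (auto simp: bt_frame_def q1 J_q0 simp flip: matrix_vector_mul_assoc)
  then show ?thesis by blast
qed

text \<open>For u in ker J^2, J u is a multiple c q0 = c J q1, so u - c q1 lies in ker J. Hence q0
  and q1 span ker J^2, and the covectors give the coordinates.\<close>

lemma frame_decomposition:
  assumes "bt_frame J q0 q1 p0 p1"
  obtains z where "w = p0 w *\<^sub>R q0 + p1 w *\<^sub>R q1 + J *v (J *v z)"
proof -
  have q1: "J *v q1 = q0" using assms by (simp add: bt_frame_def)
  have p: "linear p0" "linear p1" "p0 q0 = 1" "p1 q1 = 1" "p0 q1 = 0" "p1 q0 = 0"
    "p0 (J *v (J *v v)) = 0" "p1 (J *v (J *v v)) = 0" for v
    using assms by (auto simp: bt_frame_def simp flip: matrix_vector_mul_assoc)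
  obtain u z where w: "w = u + J *v (J *v z)" and u: "J *v (J *v u) = 0" by (rule decomposition)
  obtain c where c: "J *v u = c *\<^sub>R q0" using u by (rule kernelE)
  then have "J *v (u - c *\<^sub>R q1) = 0"
    by (simp add: matrix_vector_mult_diff_distrib matrix_vector_mult_scaleR q1)
  then obtain d where "u - c *\<^sub>R q1 = d *\<^sub>R q0" by (rule kernelE)
  then have u: "u = d *\<^sub>R q0 + c *\<^sub>R q1" by (simp add: algebra_simps)
  have "p0 w = d" "p1 w = c"
    unfolding w u by (simp_all add: p linear_add linear_cmul)
  with w u have "w = p0 w *\<^sub>R q0 + p1 w *\<^sub>R q1 + J *v (J *v z)" by simp
  then show ?thesis by (rule that)
qed

lemma trace_D0:
  assumes "bt_frame J q0 q1 p0 p1"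
  shows "trace (adj_coeff J 0 ** M) = c2 * p1 (M *v q0)"
proof -
  have q1: "J *v q1 = q0" and "linear p1" using assms by (auto simp: bt_frame_def)
  have "linear (\<lambda>w. c2 * p1 w)"
    using linear_compose_scale_right[OF \<open>linear p1\<close>, of c2] by simp
  \<comment> \<open>D_0 kills im J^2 and q0, and sends q1 to c_2 q0. The zero summand fits the shape
    of \<open>trace_mult_outer\<close>.\<close>
  moreover have "D 0 w = (c2 * p1 w) *\<^sub>R q0 + 0 *\<^sub>R q0" for w
  proof -
    obtain z where w: "w = p0 w *\<^sub>R q0 + p1 w *\<^sub>R q1 + J *v (J *v z)"
      using frame_decomposition[OF assms] by blast
    show ?thesis
      by (subst w) (simp add: matrix_vector_right_distrib matrix_vector_mult_scaleR D0_J D0_q0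
          D0_q1[OF q1] mult.commute)
  qed
  ultimately show ?thesis
    using trace_mult_outer[OF _ linear_zero, of _ "adj_coeff J 0" q0 q0 M] by simp
qed

text \<open>D_1 kills im J^2, and on ker J^2 it is c_2 I plus a nilpotent part with factor c_3. The
  latter causes the c_3 term, which the correction in \<tau> removes.\<close>

lemma trace_D1:
  assumes "bt_frame J q0 q1 p0 p1"
  shows "trace (adj_coeff J (Suc 0) ** M) =
    c2 * (p0 (M *v q0) + p1 (M *v q1)) + c3 * p1 (M *v q0)"
proof -
  have q1: "J *v q1 = q0" and "linear p0" "linear p1" using assms by (auto simp: bt_frame_def)
  note scale = linear_compose_scale_right[where f = p0 and c = c2, OF \<open>linear p0\<close>, simplified]
    linear_compose_scale_right[where f = p1, OF \<open>linear p1\<close>, simplified]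
  have "linear (\<lambda>w. c2 * p0 w + c3 * p1 w)" "linear (\<lambda>w. c2 * p1 w)"
    by (intro linear_compose_add scale)+
  moreover have "D (Suc 0) w = (c2 * p0 w + c3 * p1 w) *\<^sub>R q0 + (c2 * p1 w) *\<^sub>R q1" for w
  proof -
    obtain z where w: "w = p0 w *\<^sub>R q0 + p1 w *\<^sub>R q1 + J *v (J *v z)"
      using frame_decomposition[OF assms] by blast
    have "D (Suc 0) w = p0 w *\<^sub>R D (Suc 0) q0 + p1 w *\<^sub>R D (Suc 0) q1"
      by (subst w) (simp add: matrix_vector_right_distrib matrix_vector_mult_scaleR D1_J D0_J)
    then show ?thesis
      by (simp add: D1_q0 D1_q1[OF q1] algebra_simps)
  qed
  ultimately show ?thesis
    using trace_mult_outer[where N = "adj_coeff J (Suc 0)"] by (auto simp: algebra_simps)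
qed

end

subsection \<open>Variation of the Jacobian along the kernel\<close>

text \<open>Differentiability provides the boundedness under which \<open>Blinfun\<close> in
  \<open>Df\<close> is faithful.\<close>

lemma has_derivative_Df:
  assumes "f differentiable (at x)"
  shows "(f has_derivative blinfun_apply (Df f x)) (at x)"
  using assms has_derivative_bounded_linear[of f "frechet_derivative f (at x)" "at x"]
  by (simp add: Df_def frechet_derivative_works bounded_linear_Blinfun_apply)

text \<open>The first argument of \<open>D2\<close> is the direction in which \<open>Df\<close> is
  differentiated, so the chain rule along the line yields B(v, .).\<close>

lemma has_field_derivative_jacobian_line:
  fixes X :: "real^'n \<Rightarrow> real^'m"
  assumes "open U" "C2_on X U" "p \<in> U"
  shows "((\<lambda>s. jacobian X (at (p + s *\<^sub>R v)) $ i $ j) has_field_derivative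
    matrix (D2 X p v) $ i $ j) (at 0)"
proof -
  have "Df X differentiable (at p)" using assms by (simp add: C2_on_def)
  then have "(Df X has_derivative blinfun_apply (Df (Df X) p)) (at (p + 0 *\<^sub>R v))"
    by (simp add: has_derivative_Df)
  moreover have "((\<lambda>s. p + s *\<^sub>R v) has_derivative (\<lambda>s. s *\<^sub>R v)) (at 0)"
    by (auto intro!: derivative_eq_intros)
  ultimately have "((\<lambda>s. Df X (p + s *\<^sub>R v)) has_derivative
      (\<lambda>s. blinfun_apply (Df (Df X) p) (s *\<^sub>R v))) (at 0)"
    using has_derivative_compose by blast
  from bounded_linear.has_derivative[OF bounded_linear_compose[OF bounded_linear_vec_nth
      blinfun.bounded_linear_left] this]
  have "((\<lambda>s. blinfun_apply (Df X (p + s *\<^sub>R v)) (axis j 1) $ i) has_derivative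
      (\<lambda>s. s * D2 X p v (axis j 1) $ i)) (at 0)"
    by (simp add: D2_def blinfun.scaleR_right blinfun.scaleR_left)
  then have *: "((\<lambda>s. blinfun_apply (Df X (p + s *\<^sub>R v)) (axis j 1) $ i) has_field_derivative
      matrix (D2 X p v) $ i $ j) (at 0)"
    by (simp add: has_field_derivative_def matrix_def mult.commute[of _ "_ $ _"])
  \<comment> \<open>\<open>jacobian\<close> and \<open>Df\<close> are identified on U, so the
    derivative is transferred on the open set of s with p + s v in U.\<close>
  have "open ((\<lambda>s. p + s *\<^sub>R v) -` U)"
    by (intro open_vimage assms continuous_intros)
  moreover have "jacobian X (at x) $ i $ j = blinfun_apply (Df X x) (axis j 1) $ i" if "x \<in> U" for x
  proof -
    have "X differentiable (at x)" using assms that by (simp add: C2_on_def)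
    then have "bounded_linear (frechet_derivative X (at x))"
      by (simp add: frechet_derivative_works has_derivative_bounded_linear)
    then show ?thesis
      by (simp add: Df_def bounded_linear_Blinfun_apply jacobian_def matrix_def)
  qed
  ultimately show ?thesis
    using \<open>p \<in> U\<close>
    by (intro has_field_derivative_transform_within_open[OF *]) auto
qed

section \<open>The Bogdanov-Takens coefficients as derivatives\<close>

lemma bt_delta_eq:
  "bt_delta X x = coeff (charpoly (jacobian X (at x))) 0 / coeff (charpoly (jacobian X (at x))) 2"
  by (simp add: bt_delta_def coeff_charpoly)

text \<open>Relative to c_2, the signs of c_1 and c_3 are opposite to those of the minor sums. For n
  = 2 both c_3 and the sum of index -1 are 0.\<close>

lemma bt_tau_eq:
  "bt_tau X x =
    (bt_delta X x * coeff (charpoly (jacobian X (at x))) 3 - coeff (charpoly (jacobian X (at x))) (Suc 0))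
      / coeff (charpoly (jacobian X (at x))) 2"
  by (simp add: bt_tau_def coeff_charpoly power_add diff_divide_distrib)

theorem proposition6p2:
  fixes X :: "real^'n \<Rightarrow> real^'n"
    and U :: "(real^'n) set"
    and p q0 :: "real^'n"
    and J :: "real^'n^'n"
    and a b :: real
  assumes "CARD('n) \<ge> 2"
    and "open U"
    and "C2_on X U"
    and "p \<in> U"
    and "X p = 0"
    and "J = jacobian X (at p)"
    and "rank J = CARD('n) - 1"
    and "e_minors (int CARD('n) - 1) J = 0"
    and "e_minors (int CARD('n) - 2) J \<noteq> 0"
    and "span {q0} = {v. J *v v = 0}"
    and "(a, b) = bogdanov_takens_coeffs X p q0"
  shows "bt_delta X p = 0 \<and> bt_tau X p = 0 \<and>
    (\<lambda>s. bt_delta X (p + s *\<^sub>R q0)) field_differentiable (at 0) \<and>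
    a = - (1/2) * deriv (\<lambda>s. bt_delta X (p + s *\<^sub>R q0)) 0 \<and>
    (\<lambda>s. bt_tau X (p + s *\<^sub>R q0)) field_differentiable (at 0) \<and>
    b = deriv (\<lambda>s. bt_tau X (p + s *\<^sub>R q0)) 0"
proof -
  define c where "c k s = coeff (charpoly (jacobian X (at (p + s *\<^sub>R q0)))) k" for k s
  have c_J: "c k 0 = coeff (charpoly J) k" for k by (simp add: c_def assms)
  have "det J = 0" using assms by (simp add: det_eq_0_rank)
  then have c0: "c 0 0 = 0"
    unfolding c_J by (simp add: coeff_charpoly e_minors_CARD)
  have c1: "c (Suc 0) 0 = 0" and c2: "c 2 0 \<noteq> 0"
    unfolding c_J using assms by (simp_all add: coeff_charpoly)
  interpret double_zero_matrix J q0
    using c0 c1 c2 assms unfolding c_J by unfold_locales simp_all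
  define M where "M = matrix (D2 X p q0)"
  have M: "M *v v = D2 X p q0 v" for v
    unfolding M_def D2_def
    by (simp add: matrix_works linear_matrix_vector_mul_eq bounded_linear.linear
        blinfun.bounded_linear_right)
  have dc: "(c k has_field_derivative - trace (adj_coeff J k ** M)) (at 0)" for k
    using has_field_derivative_coeff_charpoly[OF has_field_derivative_jacobian_line, OF assms(2-4)]
    by (simp add: c_def[abs_def] M_def assms(6))
  define \<delta> where "\<delta> s = bt_delta X (p + s *\<^sub>R q0)" for s
  define \<tau> where "\<tau> s = bt_tau X (p + s *\<^sub>R q0)" for s
  have \<delta>_eq: "\<delta> s = c 0 s / c 2 s" and \<tau>_eq: "\<tau> s = (\<delta> s * c 3 s - c (Suc 0) s) / c 2 s" for s
    by (simp_all add: \<delta>_def \<tau>_def c_def bt_delta_eq bt_tau_eq)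
  have \<delta>0: "\<delta> 0 = 0" and \<tau>0: "\<tau> 0 = 0" by (simp_all add: \<delta>_eq \<tau>_eq c0 c1)
  define \<delta>' where "\<delta>' = - trace (adj_coeff J 0 ** M) / c 2 0"
  \<comment> \<open>In the quotient rule the derivatives of c_2 and c_3 drop out, as \<delta> and
    c_1 vanish at 0; the plus sign comes from c_1' = - tr (D_1 M).\<close>
  define \<tau>' where "\<tau>' = (\<delta>' * c 3 0 + trace (adj_coeff J (Suc 0) ** M)) / c 2 0"
  have d\<delta>: "(\<delta> has_field_derivative \<delta>') (at 0)"
    unfolding \<delta>_eq[abs_def] \<delta>'_def
    by (rule derivative_eq_intros dc c2 refl)+ (use c2 in \<open>simp add: c0\<close>)
  have d\<tau>: "(\<tau> has_field_derivative \<tau>') (at 0)"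
    unfolding \<tau>_eq[abs_def] \<tau>'_def
    by (rule derivative_eq_intros dc c2 d\<delta> refl)+ (use c2 in \<open>simp add: c1 \<delta>0\<close>)
  \<comment> \<open>The two c_3 terms cancel in \<tau>'. The right-hand side is independent of the
    frame, which with \<open>frame_exists\<close> determines the definite description.\<close>
  have frame: "(1/2 * p1 (D2 X p q0 q0), p0 (D2 X p q0 q0) + p1 (D2 X p q0 q1)) =
      (- (1/2) * \<delta>', \<tau>')" if "bt_frame J q0 q1 p0 p1" for q1 p0 p1
    using c2 unfolding \<tau>'_def \<delta>'_def trace_D0[OF that] trace_D1[OF that]
    by (simp add: M c_J field_simps)
  have "bogdanov_takens_coeffs X p q0 = (- (1/2) * \<delta>', \<tau>')"
    unfolding bogdanov_takens_coeffs_def assms(6)[symmetric]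
    using frame_exists frame by (intro the_equality) (metis, metis)
  then have "a = - (1/2) * \<delta>'" "b = \<tau>'" using assms by simp_all
  moreover have "deriv \<delta> 0 = \<delta>'" "deriv \<tau> 0 = \<tau>'"
    using d\<delta> d\<tau> by (auto intro: DERIV_imp_deriv)
  moreover have "\<delta> field_differentiable (at 0)" "\<tau> field_differentiable (at 0)"
    using d\<delta> d\<tau> by (auto simp: field_differentiable_def)
  ultimately show ?thesis
    using \<delta>0 \<tau>0 by (simp add: \<delta>_def[abs_def] \<tau>_def[abs_def])
qed

end
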